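(* Let $\Sigma=\Gamma\times\mathbb{R}\subset\mathbb{C}^2\cong\mathbb{R}^4$ be the Grim Reaper cylinder, i.e. the image of $$\Phi:\left(-\tfrac{\pi}{2},\tfrac{\pi}{2}\right)\times\mathbb{R}\to\mathbb{R}^4,\qquad \Phi(x,y)=(-\log\cos x,\;x,\;y,\;0).$$ Then $\Sigma$ is a Lagrangian translating soliton in $\mathbb{C}^2$, with translating vector $\mathbf{T}=(1,0,0,0)$ (that is, $\Sigma$ is Lagrangian and $\mathbf{T}^\perp=\mathbf{H}$ on $\Sigma$), and $\Sigma$ is $L$-stable: for every smooth compactly supported normal vector field $\mathbf{V}$ on $\Sigma$, $$-\int_{\Sigma}\langle L\mathbf{V},\mathbf{V}\rangle\, e^{\langle\mathbf{T},\mathbf{x}\rangle}\,d\mu\;\ge\;0 .$$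
   Context: $\mathbb{C}^2\cong\mathbb{R}^4$ carries the standard Euclidean metric $\bar g=\langle\cdot,\cdot\rangle$ and the complex structure $J(a,b,c,d)=(b,-a,d,-c)$, with Kähler form $\bar\omega$ determined by $\bar g=\bar\omega(\cdot,J\cdot)$. A 2-dimensional submanifold $\Sigma$ is Lagrangian if $\bar\omega|_\Sigma=0$, equivalently if $J$ maps each tangent space of $\Sigma$ onto the normal space at that point. The Grim Reaper $\Gamma$ is the plane curve $x\mapsto(-\log\cos x,x)$, $x\in(-\pi/2,\pi/2)$. Here $\mathbf{x}$ is the position vector, $d\mu$ is the induced area element on $\Sigma$, $\mathbf{T}^\perp$ and $\mathbf{T}^\top$ are the normal and tangential components of the constant vector $\mathbf{T}$, and $\mathbf{H}$ is the mean curvature vector of $\Sigma$ (the trace, not normalized, of the second fundamental form). A submanifold is a translating soliton if $\mathbf{T}^\perp=\mathbf{H}$ on it for some constant vector $\mathbf{T}$. The stability operator $L$ acts on normal vector fields $\mathbf{V}$ by $$L\mathbf{V}=\Delta^{\perp}\mathbf{V}+\nabla^{\perp}_{\mathbf{T}^{\top}}\mathbf{V}+\sum_{i,j}\langle A(e_i,e_j),\mathbf{V}\rangle A(e_i,e_j),$$ where $\nabla^\perp$ is the normal connection, $\Delta^\perp$ the associated Laplacian (trace of the second covariant derivative) on the normal bundle, $A$ the second fundamental form, and $\{e_i\}$ a local orthonormal tangent frame. In components with respect to a local orthonormal normal frame $\{e_\alpha\}$, with $\mathbf{V}=V^\alpha e_\alpha$, it reads $L\mathbf{V}=\left(\Delta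 V^\alpha+\langle\mathbf{T},\nabla V^\alpha\rangle+g^{ik}g^{jl}h^\alpha_{ij}h^\beta_{kl}V^\beta\right)e_\alpha$, where $g_{ij}$ is the induced metric, $h^\alpha_{ij}$ are the components of the second fundamental form, and derivatives of $V^\alpha$ are covariant derivatives. The quantity $-\int_\Sigma\langle L\mathbf{V},\mathbf{V}\rangle e^{\langle\mathbf{T},\mathbf{x}\rangle}d\mu$ is the second variation at $\Sigma$ of $F(\Sigma)=\int_\Sigma e^{\langle\mathbf{T},\mathbf{x}\rangle}d\mu$ in the direction $\mathbf{V}$. *)

theory Defs
  imports "HOL-Analysis.Analysis"
begin

section \<open>Smooth maps on open subsets of the plane\<close>

definition pd :: "2 \<Rightarrow> (real^2 \<Rightarrow> 'b::real_normed_vector) \<Rightarrow> real^2 \<Rightarrow> 'b" where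
  "pd i f p = frechet_derivative f (at p) (axis i 1)"

text \<open>For open \<open>U\<close> this is the class \<open>C\<^sup>\<infinity>\<close>: differentiability of all iterated partial
  derivatives includes their continuity. For other sets it is not meant to be used.\<close>

definition smooth_on :: "(real^2) set \<Rightarrow> (real^2 \<Rightarrow> 'b::real_normed_vector) \<Rightarrow> bool" where
  "smooth_on U f \<longleftrightarrow> (\<forall>js. \<forall>p\<in>U. foldr pd js f differentiable (at p))"


section \<open>Geometry of a parametrized surface in Euclidean 4-space\<close>

text \<open>A surface \<open>\<Sigma> = \<Phi> ` U\<close> is given by a global parametrization \<open>\<Phi>\<close> on an open set \<open>U\<close>.
  Functions and vector fields on \<open>\<Sigma>\<close> are represented by their pullbacks along \<open>\<Phi>\<close>, that
  is, as maps on the parameter domain; if \<open>\<Phi>\<close> is an embedding in the following sense, this is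
  a one-to-one correspondence that preserves smoothness and compactness of supports.\<close>

definition embedded_surface :: "(real^2) set \<Rightarrow> (real^2 \<Rightarrow> real^4) \<Rightarrow> bool" where
  "embedded_surface U \<Phi> \<longleftrightarrow>
     open U \<and> smooth_on U \<Phi> \<and>
     (\<forall>p\<in>U. inj (frechet_derivative \<Phi> (at p))) \<and>
     (\<exists>\<Psi>. homeomorphism U (\<Phi> ` U) \<Phi> \<Psi>)"

definition tangent_space :: "(real^2 \<Rightarrow> real^4) \<Rightarrow> real^2 \<Rightarrow> (real^4) set" where
  "tangent_space \<Phi> p = range (frechet_derivative \<Phi> (at p))"

definition metric :: "(real^2 \<Rightarrow> real^4) \<Rightarrow> real^2 \<Rightarrow> real^2^2" where
  "metric \<Phi> p = (\<chi> i j. pd i \<Phi> p \<bullet> pd j \<Phi> p)"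

definition metric_inv :: "(real^2 \<Rightarrow> real^4) \<Rightarrow> real^2 \<Rightarrow> real^2^2" where
  "metric_inv \<Phi> p = matrix_inv (metric \<Phi> p)"

text \<open>The components of \<open>w\<^sup>\<top>\<close> in the coordinate frame \<open>\<partial>\<^sub>j\<Phi>\<close>.\<close>

definition tangent_coeff :: "(real^2 \<Rightarrow> real^4) \<Rightarrow> real^2 \<Rightarrow> real^4 \<Rightarrow> 2 \<Rightarrow> real" where
  "tangent_coeff \<Phi> p w j = (\<Sum>i\<in>UNIV. metric_inv \<Phi> p $ i $ j * (w \<bullet> pd i \<Phi> p))"

definition tangent_part :: "(real^2 \<Rightarrow> real^4) \<Rightarrow> real^2 \<Rightarrow> real^4 \<Rightarrow> real^4" where
  "tangent_part \<Phi> p w = (\<Sum>j\<in>UNIV. tangent_coeff \<Phi> p w j *\<^sub>R pd j \<Phi> p)"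

definition normal_part :: "(real^2 \<Rightarrow> real^4) \<Rightarrow> real^2 \<Rightarrow> real^4 \<Rightarrow> real^4" where
  "normal_part \<Phi> p w = w - tangent_part \<Phi> p w"

text \<open>\<open>A(\<partial>\<^sub>i\<Phi>, \<partial>\<^sub>j\<Phi>)\<close>.\<close>

definition second_ff :: "(real^2 \<Rightarrow> real^4) \<Rightarrow> 2 \<Rightarrow> 2 \<Rightarrow> real^2 \<Rightarrow> real^4" where
  "second_ff \<Phi> i j p = normal_part \<Phi> p (pd i (pd j \<Phi>) p)"

definition mean_curvature :: "(real^2 \<Rightarrow> real^4) \<Rightarrow> real^2 \<Rightarrow> real^4" where
  "mean_curvature \<Phi> p =
     (\<Sum>i\<in>UNIV. \<Sum>j\<in>UNIV. (metric_inv \<Phi> p $ i $ j) *\<^sub>R second_ff \<Phi> i j p)"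

text \<open>\<open>\<Gamma>\<^sup>k\<^sub>i\<^sub>j\<close> of the Levi-Civita connection of the induced metric.\<close>

definition christoffel :: "(real^2 \<Rightarrow> real^4) \<Rightarrow> 2 \<Rightarrow> 2 \<Rightarrow> 2 \<Rightarrow> real^2 \<Rightarrow> real" where
  "christoffel \<Phi> k i j p =
     (1/2) * (\<Sum>l\<in>UNIV. metric_inv \<Phi> p $ k $ l *
        (pd i (\<lambda>q. metric \<Phi> q $ j $ l) p + pd j (\<lambda>q. metric \<Phi> q $ i $ l) p
          - pd l (\<lambda>q. metric \<Phi> q $ i $ j) p))"

definition normal_conn ::
  "(real^2 \<Rightarrow> real^4) \<Rightarrow> 2 \<Rightarrow> (real^2 \<Rightarrow> real^4) \<Rightarrow> real^2 \<Rightarrow> real^4" where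
  "normal_conn \<Phi> i V p = normal_part \<Phi> p (pd i V p)"

definition normal_laplacian ::
  "(real^2 \<Rightarrow> real^4) \<Rightarrow> (real^2 \<Rightarrow> real^4) \<Rightarrow> real^2 \<Rightarrow> real^4" where
  "normal_laplacian \<Phi> V p =
     (\<Sum>i\<in>UNIV. \<Sum>j\<in>UNIV. (metric_inv \<Phi> p $ i $ j) *\<^sub>R
        (normal_conn \<Phi> i (normal_conn \<Phi> j V) p
          - (\<Sum>k\<in>UNIV. christoffel \<Phi> k i j p *\<^sub>R normal_conn \<Phi> k V p)))"

text \<open>The three summands are \<open>\<Delta>\<^sup>\<bottom>V\<close>, the normal covariant derivative of \<open>V\<close> in the direction
  \<open>T\<^sup>\<top>\<close>, and the trace of \<open>\<langle>A,V\<rangle>A\<close>, written in the coordinate frame instead of a local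
  orthonormal one.\<close>

definition stability_op ::
  "(real^2 \<Rightarrow> real^4) \<Rightarrow> real^4 \<Rightarrow> (real^2 \<Rightarrow> real^4) \<Rightarrow> real^2 \<Rightarrow> real^4" where
  "stability_op \<Phi> T V p =
     normal_laplacian \<Phi> V p
     + (\<Sum>j\<in>UNIV. tangent_coeff \<Phi> p T j *\<^sub>R normal_conn \<Phi> j V p)
     + (\<Sum>i\<in>UNIV. \<Sum>j\<in>UNIV. \<Sum>k\<in>UNIV. \<Sum>l\<in>UNIV.
          (metric_inv \<Phi> p $ i $ k * metric_inv \<Phi> p $ j $ l * (second_ff \<Phi> i j p \<bullet> V p))
            *\<^sub>R second_ff \<Phi> k l p)"

definition translating_soliton ::
  "(real^2) set \<Rightarrow> (real^2 \<Rightarrow> real^4) \<Rightarrow> real^4 \<Rightarrow> bool" where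
  "translating_soliton U \<Phi> T \<longleftrightarrow> (\<forall>p\<in>U. normal_part \<Phi> p T = mean_curvature \<Phi> p)"

definition compact_normal_field ::
  "(real^2) set \<Rightarrow> (real^2 \<Rightarrow> real^4) \<Rightarrow> (real^2 \<Rightarrow> real^4) \<Rightarrow> bool" where
  "compact_normal_field U \<Phi> V \<longleftrightarrow>
     smooth_on U V \<and>
     (\<forall>p\<in>U. \<forall>w\<in>tangent_space \<Phi> p. V p \<bullet> w = 0) \<and>
     (\<exists>K. compact K \<and> K \<subseteq> U \<and> (\<forall>p\<in>U - K. V p = 0))"

text \<open>\<open>\<integral>\<^bsub>\<Sigma>\<^esub> f d\<mu>\<close> for injective \<open>\<Phi>\<close>, the area element being \<open>d\<mu> = sqrt (det g) dx dy\<close>.\<close>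

definition surface_integral ::
  "(real^2) set \<Rightarrow> (real^2 \<Rightarrow> real^4) \<Rightarrow> (real^2 \<Rightarrow> real) \<Rightarrow> real" where
  "surface_integral U \<Phi> f = (LINT p:U|lborel. f p * sqrt (det (metric \<Phi> p)))"


section \<open>The complex structure and Lagrangian surfaces\<close>

lemma vector_4:
  "(vector [a, b, c, d] :: real^4) $ 1 = a"
  "(vector [a, b, c, d] :: real^4) $ 2 = b"
  "(vector [a, b, c, d] :: real^4) $ 3 = c"
  "(vector [a, b, c, d] :: real^4) $ 4 = d"
  unfolding vector_def by simp_all

definition J :: "real^4 \<Rightarrow> real^4" where
  "J u = vector [u $ 2, - (u $ 1), u $ 4, - (u $ 3)]"

definition kahler_form :: "real^4 \<Rightarrow> real^4 \<Rightarrow> real" where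
  "kahler_form u v = - (u \<bullet> J v)"

text \<open>The form is the one determined by the convention \<open>\<langle>u, v\<rangle> = \<omega>(u, J v)\<close>:\<close>

lemma J_J: "J (J u) = - u"
  by (simp add: J_def vec_eq_iff forall_4 vector_4)

lemma kahler_form_unique: "(\<forall>u v. u \<bullet> v = \<omega> u (J v)) \<longleftrightarrow> \<omega> = kahler_form"
proof
  assume h: "\<forall>u v. u \<bullet> v = \<omega> u (J v)"
  have neg: "J (- v) = - J v" for v
    by (simp add: J_def vec_eq_iff forall_4 vector_4)
  have "\<omega> u v = kahler_form u v" for u v
    using h[rule_format, of u "- J v"] by (simp add: kahler_form_def neg J_J)
  then show "\<omega> = kahler_form" by blast
next
  assume "\<omega> = kahler_form"
  then show "\<forall>u v. u \<bullet> v = \<omega> u (J v)"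
    by (simp add: kahler_form_def J_J)
qed

definition lagrangian_surface :: "(real^2) set \<Rightarrow> (real^2 \<Rightarrow> real^4) \<Rightarrow> bool" where
  "lagrangian_surface U \<Phi> \<longleftrightarrow>
     (\<forall>p\<in>U. \<forall>v\<in>tangent_space \<Phi> p. \<forall>w\<in>tangent_space \<Phi> p. kahler_form v w = 0)"


section \<open>The Grim Reaper cylinder\<close>

definition grim_domain :: "(real^2) set" where
  "grim_domain = {p. - (pi/2) < p $ 1 \<and> p $ 1 < pi/2}"

definition grim_cylinder :: "real^2 \<Rightarrow> real^4" where
  "grim_cylinder p = vector [- ln (cos (p $ 1)), p $ 1, p $ 2, 0]"

definition grim_T :: "real^4" where
  "grim_T = vector [1, 0, 0, 0]"

end

theory Submission
  imports Defs
begin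

text \<open>
  The normal bundle of the cylinder is flat: the unit fields \<open>n = (cos x, - sin x, 0, 0)\<close> and
  \<open>e\<^sub>4\<close> are parallel. For \<open>V = u n + w e\<^sub>4\<close> one finds
  \<open>L V = (cos\<^sup>2 x (u\<^sub>x\<^sub>x + u) + u\<^sub>y\<^sub>y) n + (cos\<^sup>2 x w\<^sub>x\<^sub>x + w\<^sub>y\<^sub>y) e\<^sub>4\<close>, while the weight
  and the area element contribute \<open>1 / cos\<^sup>2 x\<close>. The only term of the wrong sign is \<open>- u\<^sup>2\<close>, and it
  is absorbed pointwise by the Picone-type identity
  \<open>- u (u\<^sub>x\<^sub>x + u) = (u\<^sub>x + u tan x)\<^sup>2 - (u u\<^sub>x + u\<^sup>2 tan x)\<^sub>x\<close>, which comes from the positive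
  solution \<open>cos x\<close> of \<open>f'' + f = 0\<close>. So the integrand is a sum of squares minus a divergence
  with compact support.
\<close>

section \<open>Partial derivatives and smooth functions\<close>

lemma pd_eqI: "(f has_derivative f') (at p) \<Longrightarrow> pd i f p = f' (axis i 1)"
  unfolding pd_def by (simp add: frechet_derivative_at[symmetric])

text \<open>\<open>frechet_derivative\<close> is a choice among the derivatives at the point.
  Functions that agree near \<open>p\<close> have the same derivatives there, so the two choices
  coincide, even where no derivative exists.\<close>

lemma pd_cong:
  assumes "open U" "p \<in> U" "\<And>q. q \<in> U \<Longrightarrow> f q = g q"
  shows "pd i f p = pd i g p"
proof -
  have "(f has_derivative D) (at p) \<longleftrightarrow> (g has_derivative D) (at p)" for D
    using has_derivative_transform_within_open[OF _ assms(1,2)] assms(3) by metis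
  then show ?thesis by (simp add: pd_def frechet_derivative_def)
qed

lemma differentiable_cong_open:
  assumes "open U" "p \<in> U" "\<And>q. q \<in> U \<Longrightarrow> f q = g q"
  shows "f differentiable (at p) \<longleftrightarrow> g differentiable (at p)"
  unfolding differentiable_def
  using has_derivative_transform_within_open[OF _ assms(1,2)] assms(3) by metis

lemma pd_add:
  assumes "f differentiable (at p)" "g differentiable (at p)"
  shows "pd i (\<lambda>q. f q + g q) p = pd i f p + pd i g p"
  using pd_eqI[OF has_derivative_add[OF assms[THEN frechet_derivative_works[THEN iffD1]]]]
  by (simp add: pd_def)

lemma pd_mult:
  fixes f g :: "real^2 \<Rightarrow> real"
  assumes "f differentiable (at p)" "g differentiable (at p)"
  shows "pd i (\<lambda>q. f q * g q) p = f p * pd i g p + pd i f p * g p"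
  using pd_eqI[OF has_derivative_mult[OF assms[THEN frechet_derivative_works[THEN iffD1]]]]
  by (simp add: pd_def)

lemma pd_bounded_linear:
  assumes "bounded_linear h" "f differentiable (at p)"
  shows "pd i (\<lambda>q. h (f q)) p = h (pd i f p)"
  using pd_eqI[OF bounded_linear.has_derivative[OF assms(1) assms(2)[THEN frechet_derivative_works[THEN iffD1]]]]
  by (simp add: pd_def)

section \<open>Closure properties of smooth functions\<close>

lemma smooth_on_differentiable: "smooth_on U f \<Longrightarrow> p \<in> U \<Longrightarrow> f differentiable (at p)"
  unfolding smooth_on_def by (drule spec[of _ "[]"]) simp

lemma smooth_on_continuous_on: "smooth_on U f \<Longrightarrow> continuous_on U f"
  by (simp add: continuous_at_imp_continuous_on differentiable_imp_continuous_within smooth_on_differentiable)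

lemma smooth_on_pd: "smooth_on U f \<Longrightarrow> smooth_on U (pd i f)"
  unfolding smooth_on_def
proof (intro allI)
  fix js assume "\<forall>js. \<forall>p\<in>U. foldr pd js f differentiable (at p)"
  \<comment> \<open>\<open>foldr\<close> applies the last entry of the list first, so the innermost
    derivative is appended at the end.\<close>
  from this[rule_format, of _ "js @ [i]"]
  show "\<forall>p\<in>U. foldr pd js (pd i f) differentiable (at p)" by simp
qed

lemma foldr_pd_cong:
  assumes "open U" "\<And>q. q \<in> U \<Longrightarrow> f q = g q" "p \<in> U"
  shows "foldr pd js f p = foldr pd js g p"
  using assms(3)
proof (induction js arbitrary: p)
  case (Cons j js)
  show ?case using pd_cong[OF assms(1) Cons.prems Cons.IH] by simp
qed (simp add: assms(2))

lemma smooth_on_cong: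
  assumes "open U" "\<And>q. q \<in> U \<Longrightarrow> f q = g q"
  shows "smooth_on U f \<longleftrightarrow> smooth_on U g"
  unfolding smooth_on_def
proof -
  have "foldr pd js f differentiable (at p) \<longleftrightarrow> foldr pd js g differentiable (at p)" if "p \<in> U" for js p
    by (rule differentiable_cong_open[OF assms(1) that foldr_pd_cong[OF assms]])
  then show "(\<forall>js. \<forall>p\<in>U. foldr pd js f differentiable (at p)) \<longleftrightarrow>
    (\<forall>js. \<forall>p\<in>U. foldr pd js g differentiable (at p))" by blast
qed

text \<open>Smoothness is the largest class of functions that are differentiable on \<open>U\<close>
  and closed under \<open>pd\<close>. Since \<open>U\<close> is open and \<open>pd\<close> is local,
  closure up to equality on \<open>U\<close> is enough, so families of explicit formulas can serve
  as \<open>P\<close>.\<close>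

lemma smooth_on_coinduct:
  assumes "open U" "f \<in> P"
    and "\<And>g p. g \<in> P \<Longrightarrow> p \<in> U \<Longrightarrow> g differentiable (at p)"
    and step: "\<And>g i. g \<in> P \<Longrightarrow> \<exists>h\<in>P. \<forall>p\<in>U. pd i g p = h p"
  shows "smooth_on U f"
  unfolding smooth_on_def
proof (intro allI ballI)
  fix js p assume p: "p \<in> U"
  have "\<exists>h\<in>P. \<forall>p\<in>U. foldr pd js f p = h p"
  proof (induction js)
    case Nil
    then show ?case using assms(2) by auto
  next
    case (Cons j js)
    then obtain h where h: "h \<in> P" "\<forall>p\<in>U. foldr pd js f p = h p" by blast
    obtain k where k: "k \<in> P" "\<forall>p\<in>U. pd j h p = k p" using step[OF h(1)] by blast
    have "pd j (foldr pd js f) p = k p" if "p \<in> U" for p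
      using pd_cong[OF assms(1) that, of "foldr pd js f" h] h(2) k(2) that by simp
    then show ?case using k(1) by auto
  qed
  then obtain h where "h \<in> P" "\<And>p. p \<in> U \<Longrightarrow> foldr pd js f p = h p" by blast
  then show "foldr pd js f differentiable (at p)"
    using differentiable_cong_open[OF assms(1) p] assms(3)[OF _ p] by blast
qed

lemma smooth_on_add:
  assumes "open U" "smooth_on U f" "smooth_on U g"
  shows "smooth_on U (\<lambda>p. f p + g p)"
proof (rule smooth_on_coinduct[where P = "{\<lambda>p. f p + g p |f g. smooth_on U f \<and> smooth_on U g}"])
  fix h i assume "h \<in> {\<lambda>p. f p + g p |f g. smooth_on U f \<and> smooth_on U g}"
  then obtain f g where h: "h = (\<lambda>p. f p + g p)" and s: "smooth_on U f" "smooth_on U g" by blast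
  show "\<exists>k\<in>{\<lambda>p. f p + g p |f g. smooth_on U f \<and> smooth_on U g}. \<forall>p\<in>U. pd i h p = k p"
    by (rule bexI[of _ "\<lambda>p. pd i f p + pd i g p"])
       (use s in \<open>auto simp: h pd_add smooth_on_differentiable intro: smooth_on_pd\<close>)
qed (use assms in \<open>auto simp: smooth_on_differentiable\<close>)

lemma smooth_on_bounded_linear:
  assumes "open U" "bounded_linear h" "smooth_on U f"
  shows "smooth_on U (\<lambda>p. h (f p))"
proof (rule smooth_on_coinduct[where P = "{\<lambda>p. h (f p) |f. smooth_on U f}"])
  fix k i assume "k \<in> {\<lambda>p. h (f p) |f. smooth_on U f}"
  then obtain f where k: "k = (\<lambda>p. h (f p))" and s: "smooth_on U f" by blast
  show "\<exists>k'\<in>{\<lambda>p. h (f p) |f. smooth_on U f}. \<forall>p\<in>U. pd i k p = k' p"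
    by (rule bexI[of _ "\<lambda>p. h (pd i f p)"])
       (use s in \<open>auto simp: k pd_bounded_linear[OF assms(2)] smooth_on_differentiable intro: smooth_on_pd\<close>)
next
  fix k p assume "k \<in> {\<lambda>p. h (f p) |f. smooth_on U f}" "p \<in> U"
  then obtain f where k: "k = (\<lambda>p. h (f p))" and "f differentiable (at p)"
    using smooth_on_differentiable by blast
  then show "k differentiable (at p)"
    unfolding k differentiable_def using bounded_linear.has_derivative[OF assms(2)] by blast
qed (use assms in auto)

text \<open>A class containing all products of two smooth functions and closed under partial derivatives,
  as needed by \<open>smooth_on_coinduct\<close>.\<close>

inductive_set sums_of_products :: "(real^2) set \<Rightarrow> (real^2 \<Rightarrow> real) set" for U where
  prod: "smooth_on U f \<Longrightarrow> smooth_on U g \<Longrightarrow> (\<lambda>p. f p * g p) \<in> sums_of_products U"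
| add: "f \<in> sums_of_products U \<Longrightarrow> g \<in> sums_of_products U \<Longrightarrow> (\<lambda>p. f p + g p) \<in> sums_of_products U"

lemma smooth_on_mult:
  fixes f g :: "real^2 \<Rightarrow> real"
  assumes "open U" "smooth_on U f" "smooth_on U g"
  shows "smooth_on U (\<lambda>p. f p * g p)"
proof (rule smooth_on_coinduct[where P = "sums_of_products U"])
  have diff: "h differentiable (at p)" if "h \<in> sums_of_products U" "p \<in> U" for h p
    using that by (induction rule: sums_of_products.induct) (auto simp: smooth_on_differentiable)
  then show "h differentiable (at p)" if "h \<in> sums_of_products U" "p \<in> U" for h p
    using that .
  show "\<exists>k\<in>sums_of_products U. \<forall>p\<in>U. pd i h p = k p" if "h \<in> sums_of_products U" for h i
    using that
  proof (induction rule: sums_of_products.induct)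
    case (prod f g)
    then show ?case
      by (intro bexI[of _ "\<lambda>p. f p * pd i g p + pd i f p * g p"])
         (auto simp: pd_mult smooth_on_differentiable intro!: sums_of_products.intros smooth_on_pd)
  next
    case (add f g)
    then obtain f' g' where "f' \<in> sums_of_products U" "\<forall>p\<in>U. pd i f p = f' p"
      "g' \<in> sums_of_products U" "\<forall>p\<in>U. pd i g p = g' p" by blast
    then show ?case using add.hyps
      by (intro bexI[of _ "\<lambda>p. f' p + g' p"])
         (auto simp: pd_add diff intro: sums_of_products.add)
  qed
qed (use assms in \<open>auto intro: sums_of_products.prod\<close>)


section \<open>The integral of a partial derivative\<close>

text \<open>Restriction to a line parallel to an axis makes the mean value theorem and the
  difference quotient of one real variable available for \<open>pd\<close>.\<close>

lemma has_real_derivative_along_axis: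
  fixes f :: "real^2 \<Rightarrow> real"
  assumes "f differentiable (at (p + t *\<^sub>R axis i 1))"
  shows "((\<lambda>t. f (p + t *\<^sub>R axis i 1)) has_real_derivative pd i f (p + t *\<^sub>R axis i 1)) (at t)"
proof -
  let ?q = "p + t *\<^sub>R axis i 1"
  have "((\<lambda>t. f (p + t *\<^sub>R axis i 1)) has_derivative
      (\<lambda>u. frechet_derivative f (at ?q) (u *\<^sub>R axis i 1))) (at t)"
    by (rule has_derivative_compose[of "\<lambda>t. p + t *\<^sub>R axis i 1"])
       (use assms in \<open>auto simp: frechet_derivative_works intro!: derivative_eq_intros\<close>)
  moreover have "frechet_derivative f (at ?q) (u *\<^sub>R axis i 1) = pd i f ?q * u" for u
    unfolding pd_def
    using linear_cmul[OF linear_frechet_derivative[OF assms], of u "axis i 1"] by simp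
  ultimately show ?thesis by (simp add: has_field_derivative_def mult_commute_abs)
qed

text \<open>The steps \<open>1 / (n + 1)\<close> turn the limit into one along a sequence, the form
  that dominated convergence takes.\<close>

lemma pd_eq_lim:
  fixes f :: "real^2 \<Rightarrow> real"
  assumes "f differentiable (at p)"
  shows "(\<lambda>n. real (Suc n) * (f (p + (1 / real (Suc n)) *\<^sub>R axis i 1) - f p)) \<longlonglongrightarrow> pd i f p"
proof -
  have lim: "((\<lambda>t. (f (p + t *\<^sub>R axis i 1) - f p) / t) \<longlongrightarrow> pd i f p) (at 0)"
    using has_real_derivative_along_axis[of f p 0 i] assms by (simp add: DERIV_def)
  have "filterlim (\<lambda>n. 1 / real (Suc n)) (at 0) sequentially"
    unfolding filterlim_at using LIMSEQ_inverse_real_of_nat by (simp add: inverse_eq_divide)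
  from filterlim_compose[OF lim this] show ?thesis by (simp add: mult.commute)
qed

lemma pd_eq_0_outside:
  assumes "closed K" "\<And>q. q \<notin> K \<Longrightarrow> f q = 0" "p \<notin> K"
  shows "pd i f p = 0"
proof -
  have "pd i f p = pd i (\<lambda>_. 0) p"
    by (rule pd_cong[of "- K"]) (use assms in auto)
  also have "\<dots> = 0" by (rule pd_eqI[OF has_derivative_const])
  finally show ?thesis .
qed

text \<open>By translation invariance the difference quotients of \<open>f\<close> have integral \<open>0\<close>;
  dominated convergence passes to the limit.\<close>

lemma integral_pd_eq_0:
  fixes f :: "real^2 \<Rightarrow> real"
  assumes diff: "\<And>p. f differentiable (at p)" and cont: "continuous_on UNIV (pd i f)"
    and K: "compact K" "\<And>p. p \<notin> K \<Longrightarrow> f p = 0"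
  shows "integrable lborel (pd i f)" "integral\<^sup>L lborel (pd i f) = 0"
proof -
  have pd0: "pd i f p = 0" if "p \<notin> K" for p
    by (rule pd_eq_0_outside[OF compact_imp_closed[OF K(1)] K(2) that])
  have fcont: "continuous_on UNIV f"
    using diff differentiable_imp_continuous_within continuous_at_imp_continuous_on by blast
  have intf: "integrable lborel f"
  proof -
    have "integrable lborel (\<lambda>x. indicator K x *\<^sub>R f x)"
      using borel_integrable_compact[OF K(1)] continuous_on_subset[OF fcont] by blast
    moreover have "(\<lambda>x. indicator K x *\<^sub>R f x) = f" using K(2) by (fastforce simp: indicator_def)
    ultimately show ?thesis by simp
  qed
  have "compact (pd i f ` K)"
    using K(1) cont continuous_on_subset compact_continuous_image by blast
  then obtain B where "\<forall>y\<in>pd i f ` K. norm y \<le> B"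
    using compact_imp_bounded bounded_iff by blast
  \<comment> \<open>The maximum with 0 covers the points outside \<open>K\<close>, where
    \<open>pd i f\<close> vanishes, and an empty \<open>K\<close>, for which \<open>B\<close> may be
    negative.\<close>
  then have B: "\<bar>pd i f p\<bar> \<le> max B 0" for p using pd0[of p] by (cases "p \<in> K") auto
  obtain R where R: "\<And>p. p \<in> K \<Longrightarrow> norm p \<le> R" using compact_imp_bounded[OF K(1)] bounded_iff by blast
  define s where "s n p = real (Suc n) * (f (p + (1 / real (Suc n)) *\<^sub>R axis i 1) - f p)" for n p
  \<comment> \<open>An integrable bound independent of \<open>n\<close>. On the ball, the mean value
    theorem turns the quotient into a value of \<open>pd i f\<close>. Off the ball, \<open>p\<close>
    and its translate by a vector of norm at most 1 both miss \<open>K\<close>, so the quotient is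
    0.\<close>
  have s_bound: "norm (s n p) \<le> max B 0 * indicator (cball 0 (R + 1)) p" for n p
  proof (cases "p \<in> cball 0 (R + 1)")
    case True
    define h where "h = 1 / real (Suc n)"
    have h: "h > 0" by (simp add: h_def)
    obtain z where z: "f (p + h *\<^sub>R axis i 1) - f (p + 0 *\<^sub>R axis i 1) = (h - 0) * pd i f (p + z *\<^sub>R axis i 1)"
      using MVT2[OF h has_real_derivative_along_axis[OF diff]] by blast
    have "s n p = pd i f (p + z *\<^sub>R axis i 1)"
      using z h by (simp add: s_def h_def)
    then show ?thesis using B True by simp
  next
    case False
    let ?c = "(1 / real (Suc n)) *\<^sub>R axis i 1 :: real^2"
    have "norm ?c \<le> 1" by (simp add: norm_axis_1)
    moreover have "norm p \<le> norm (p + ?c) + norm ?c"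
      using norm_triangle_ineq4[of "p + ?c" ?c] by simp
    moreover have "norm p > R + 1" using False by simp
    ultimately have "norm (p + ?c) > R" "norm p > R" by linarith+
    then have "p + (1 / real (Suc n)) *\<^sub>R axis i 1 \<notin> K" "p \<notin> K" using R by fastforce+
    then show ?thesis by (simp add: s_def K(2) False)
  qed
  have s_int: "integral\<^sup>L lborel (s n) = 0" for n
  proof -
    let ?c = "(1 / real (Suc n)) *\<^sub>R axis i 1 :: real^2"
    have m: "f \<in> borel_measurable borel" using fcont by (rule borel_measurable_continuous_onI)
    have d: "distr lborel borel ((+) ?c) = lborel" by (rule lborel_distr_plus)
    have "integrable (distr lborel borel ((+) ?c)) f" unfolding d by (rule intf)
    then have i: "integrable lborel (\<lambda>p. f (?c + p))" by (subst (asm) integrable_distr_eq) (use m in auto)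
    have "integral\<^sup>L (distr lborel borel ((+) ?c)) f = integral\<^sup>L lborel (\<lambda>p. f (?c + p))"
      by (subst integral_distr) (use m in auto)
    then have "integral\<^sup>L lborel (\<lambda>p. f (?c + p)) = integral\<^sup>L lborel f" unfolding d by simp
    then have "(\<integral>p. f (?c + p) - f p \<partial>lborel) = 0"
      using i intf by (simp add: Bochner_Integration.integral_diff)
    moreover have "s n = (\<lambda>p. real (Suc n) * (f (?c + p) - f p))"
      by (intro ext) (simp only: s_def add.commute[of _ ?c])
    ultimately show ?thesis by simp
  qed
  have meas: "pd i f \<in> borel_measurable lborel" "s n \<in> borel_measurable lborel" for n
    using borel_measurable_continuous_onI[OF cont] borel_measurable_continuous_onI[OF fcont]
    by (auto simp: s_def[abs_def])
  have w: "integrable lborel (\<lambda>p. max B 0 * indicator (cball 0 (R + 1) :: (real^2) set) p)"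
    by (intro integrable_mult_right integrable_real_indicator)
       (use emeasure_compact_finite[OF compact_cball, of 0 "R + 1"] in auto)
  have lim: "(\<lambda>n. s n p) \<longlonglongrightarrow> pd i f p" for p
    using pd_eq_lim[OF diff, of p i] by (simp add: s_def)
  show "integrable lborel (pd i f)"
    by (rule integrable_dominated_convergence[where s = s, OF meas w AE_I2 AE_I2]) (rule lim s_bound)+
  have "(\<lambda>n. integral\<^sup>L lborel (s n)) \<longlonglongrightarrow> integral\<^sup>L lborel (pd i f)"
    by (rule integral_dominated_convergence[where s = s, OF meas w AE_I2 AE_I2]) (rule lim s_bound)+
  then show "integral\<^sup>L lborel (pd i f) = 0" by (simp add: s_int LIMSEQ_const_iff)
qed

text \<open>Extension of \<open>f\<close> by zero reduces this to the whole plane. The open sets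
  \<open>U\<close> and \<open>- K\<close> cover the plane; the extension equals \<open>f\<close> on
  the first and 0 on the second, so it is differentiable everywhere with continuous
  \<open>pd i\<close>.\<close>

lemma set_integral_pd_eq_0:
  fixes f :: "real^2 \<Rightarrow> real"
  assumes "open U" and diff: "\<And>p. p \<in> U \<Longrightarrow> f differentiable (at p)"
    and cont: "continuous_on U (pd i f)"
    and K: "compact K" "K \<subseteq> U" "\<And>p. p \<in> U - K \<Longrightarrow> f p = 0"
  shows "set_integrable lborel U (pd i f)" "(LINT p:U|lborel. pd i f p) = 0"
proof -
  define g where "g p = (if p \<in> U then f p else 0)" for p
  have g0: "g p = 0" if "p \<notin> K" for p using K that by (auto simp: g_def)
  have opK: "open (- K)" using K(1) compact_imp_closed by blast
  have pdU: "pd i g p = pd i f p" if "p \<in> U" for p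
    using that by (intro pd_cong[OF assms(1)]) (auto simp: g_def)
  have pd0: "pd i g p = 0" if "p \<notin> K" for p
    by (rule pd_eq_0_outside[OF compact_imp_closed[OF K(1)] g0 that])
  have gd: "g differentiable (at p)" for p
  proof (cases "p \<in> U")
    case True
    have "g differentiable (at p) \<longleftrightarrow> f differentiable (at p)"
      by (rule differentiable_cong_open[OF assms(1) True]) (simp add: g_def)
    then show ?thesis using diff True by blast
  next
    case False
    then have "p \<in> - K" using K by blast
    have "g differentiable (at p) \<longleftrightarrow> (\<lambda>_. 0 :: real) differentiable (at p)"
      by (rule differentiable_cong_open[OF opK \<open>p \<in> - K\<close>]) (simp add: g0)
    then show ?thesis by simp
  qed
  have "continuous_on (U \<union> - K) (pd i g)"
  proof (rule continuous_on_open_Un[OF assms(1) opK])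
    show "continuous_on U (pd i g)" using cont pdU continuous_on_cong by metis
    show "continuous_on (- K) (pd i g)"
      using continuous_on_cong[of "- K" "- K" "pd i g" "\<lambda>_. 0"] pd0 by simp
  qed
  moreover have "U \<union> - K = UNIV" using K(2) by blast
  ultimately have "continuous_on UNIV (pd i g)" by simp
  note * = integral_pd_eq_0[OF gd this K(1) g0]
  have eq: "(\<lambda>p. indicator U p *\<^sub>R pd i f p) = pd i g"
    using pdU pd0 K(2) by (fastforce simp: indicator_def)
  show "set_integrable lborel U (pd i f)" "(LINT p:U|lborel. pd i f p) = 0"
    unfolding set_integrable_def set_lebesgue_integral_def eq using * by simp_all
qed


section \<open>The geometry of the Grim Reaper cylinder\<close>

lemmas coord_simps = vec_eq_iff forall_2 forall_4 sum_2 sum_4 inner_vec_def vector_4 axis_def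

section \<open>Domain and coordinate frame\<close>

lemma open_grim_domain: "open grim_domain"
proof -
  have "grim_domain = {p. - (pi/2) < p $ 1} \<inter> {p. p $ 1 < pi/2}" by (auto simp: grim_domain_def)
  moreover have "open \<dots>"
    by (intro open_Int open_Collect_less continuous_intros)
  ultimately show ?thesis by simp
qed

lemma cos_pos_grim_domain: "p \<in> grim_domain \<Longrightarrow> 0 < cos (p $ 1)"
  by (auto simp: grim_domain_def intro: cos_gt_zero_pi)

lemma has_derivative_vec_nth [derivative_intros]:
  "(f has_derivative f') F \<Longrightarrow> ((\<lambda>p. f p $ i) has_derivative (\<lambda>h. f' h $ i)) F"
  using bounded_linear.has_derivative[OF bounded_linear_vec_nth] .

text \<open>An expansion in the standard basis, to which the derivative rules apply.\<close>

lemma grim_cylinder_eq: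
  "grim_cylinder p = (- ln (cos (p $ 1))) *\<^sub>R axis 1 1 + (p $ 1) *\<^sub>R axis 2 1 + (p $ 2) *\<^sub>R axis 3 1"
  by (simp add: grim_cylinder_def coord_simps)

lemma has_derivative_grim_cylinder:
  assumes "p \<in> grim_domain"
  shows "(grim_cylinder has_derivative (\<lambda>h. (h $ 1) *\<^sub>R vector [tan (p $ 1), 1, 0, 0] + (h $ 2) *\<^sub>R axis 3 1)) (at p)"
  unfolding grim_cylinder_eq[abs_def]
  using cos_pos_grim_domain[OF assms]
  by (auto intro!: derivative_eq_intros simp: coord_simps tan_def field_simps)

lemma frechet_derivative_grim_cylinder:
  "p \<in> grim_domain \<Longrightarrow> frechet_derivative grim_cylinder (at p) =
    (\<lambda>h. (h $ 1) *\<^sub>R vector [tan (p $ 1), 1, 0, 0] + (h $ 2) *\<^sub>R axis 3 1)"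
  using frechet_derivative_at[OF has_derivative_grim_cylinder] by simp

lemma pd_grim_cylinder:
  assumes "p \<in> grim_domain"
  shows "pd 1 grim_cylinder p = vector [tan (p $ 1), 1, 0, 0]"
    and "pd 2 grim_cylinder p = axis 3 1"
  using pd_eqI[OF has_derivative_grim_cylinder[OF assms]] by (simp_all add: axis_def)

section \<open>Smoothness and embedding\<close>

lemma pd_first_coord:
  assumes "(h has_real_derivative D) (at (p $ 1))"
  shows "pd 1 (\<lambda>q. h (q $ 1)) p = D" "pd 2 (\<lambda>q. h (q $ 1)) p = 0"
    and "(\<lambda>q. h (q $ 1)) differentiable (at p)"
proof -
  have *: "((\<lambda>q. h (q $ 1)) has_derivative (\<lambda>v. D * v $ 1)) (at p)"
    using has_derivative_compose[of "\<lambda>q. q $ 1" "\<lambda>v. v $ 1" p UNIV h "(*) D"] assms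
      has_derivative_vec_nth[OF has_derivative_ident]
    by (auto simp: has_field_derivative_def)
  show "pd 1 (\<lambda>q. h (q $ 1)) p = D" "pd 2 (\<lambda>q. h (q $ 1)) p = 0"
    using pd_eqI[OF *] by (simp_all add: axis_def)
  show "(\<lambda>q. h (q $ 1)) differentiable (at p)" using * by (auto simp: differentiable_def)
qed

text \<open>The derivative of \<open>tan\<close> is \<open>1 + tan^2\<close>, encoded by
  \<open>[:1, 0, 1:]\<close>. Hence the polynomials in \<open>tan\<close> are closed under
  differentiation and form a family for \<open>smooth_on_coinduct\<close>.\<close>

lemma DERIV_tan_poly:
  assumes "cos x \<noteq> 0"
  shows "((\<lambda>x. poly h (tan x)) has_real_derivative poly (pderiv h * [:1, 0, 1:]) (tan x)) (at x)"
proof -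
  have *: "inverse ((cos x)\<^sup>2) = 1 + (tan x)\<^sup>2"
    using tan_sec[OF assms] by (simp add: power_inverse)
  show ?thesis
    using DERIV_chain2[OF poly_DERIV DERIV_tan[OF assms], of h] unfolding *
    by (simp add: power2_eq_square algebra_simps)
qed

lemma smooth_on_tan_poly: "smooth_on grim_domain (\<lambda>p. poly h (tan (p $ 1)))"
proof (rule smooth_on_coinduct[OF open_grim_domain, where P = "range (\<lambda>h p. poly h (tan (p $ 1)))"])
  fix g :: "real^2 \<Rightarrow> real"
  assume "g \<in> range (\<lambda>h p. poly h (tan (p $ 1)))"
  then obtain h where g: "g = (\<lambda>p. poly h (tan (p $ 1)))" by (elim rangeE)
  have D: "((\<lambda>x. poly h (tan x)) has_real_derivative poly (pderiv h * [:1, 0, 1:]) (tan (p $ 1))) (at (p $ 1))"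
    if "p \<in> grim_domain" for p
    by (rule DERIV_tan_poly) (use cos_pos_grim_domain[OF that] in simp)
  show "g differentiable (at p)" if "p \<in> grim_domain" for p
    unfolding g using pd_first_coord(3)[OF D[OF that]] .
  show "\<exists>k\<in>range (\<lambda>h p. poly h (tan (p $ 1))). \<forall>p\<in>grim_domain. pd i g p = k p" for i
  proof (intro bexI ballI)
    show "pd i g p = poly (if i = 1 then pderiv h * [:1, 0, 1:] else 0) (tan (p $ 1))"
      if "p \<in> grim_domain" for p
    proof (cases "i = 1")
      case True
      then show ?thesis unfolding g using pd_first_coord(1)[OF D[OF that]] by simp
    next
      case False
      then have "i = 2" using exhaust_2[of i] by blast
      then show ?thesis unfolding g using pd_first_coord(2)[OF D[OF that]] by simp
    qed
  qed (rule rangeI)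
qed (rule rangeI)

lemma smooth_on_const: "smooth_on U (\<lambda>_. c)"
  unfolding smooth_on_def
proof (intro allI ballI)
  fix js p
  have "\<exists>d. foldr pd js (\<lambda>_ :: real^2. c) = (\<lambda>_. d)"
  proof (induction js)
    case (Cons j js)
    then obtain d where "foldr pd js (\<lambda>_ :: real^2. c) = (\<lambda>_. d)" by blast
    then have "foldr pd (j # js) (\<lambda>_ :: real^2. c) = (\<lambda>_. 0)"
      by (auto simp: pd_eqI[OF has_derivative_const])
    then show ?case by blast
  qed auto
  then show "foldr pd js (\<lambda>_. c) differentiable (at p)" by auto
qed

text \<open>The coordinate \<open>- ln (cos x)\<close> is not a polynomial in \<open>tan x\<close>,
  but its derivative \<open>tan x\<close> is. So smoothness is shown for the first partial
  derivatives, and differentiability of the map itself is added.\<close>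

lemma smooth_on_grim_cylinder: "smooth_on grim_domain grim_cylinder"
  unfolding smooth_on_def
proof (intro allI ballI)
  fix js p assume p: "p \<in> grim_domain"
  have "smooth_on grim_domain (\<lambda>p. (poly [:0, 1:] (tan (p $ 1))) *\<^sub>R axis 1 1 + axis 2 1 :: real^4)"
    by (intro smooth_on_add[OF open_grim_domain] smooth_on_const
        smooth_on_bounded_linear[OF open_grim_domain bounded_linear_scaleR_left] smooth_on_tan_poly)
  moreover have "pd 1 grim_cylinder p = (poly [:0, 1:] (tan (p $ 1))) *\<^sub>R axis 1 1 + axis 2 1"
    if "p \<in> grim_domain" for p
    by (simp add: pd_grim_cylinder[OF that] coord_simps)
  ultimately have "smooth_on grim_domain (pd 1 grim_cylinder)"
    by (subst smooth_on_cong[OF open_grim_domain])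
  moreover have "smooth_on grim_domain (pd 2 grim_cylinder)"
    by (subst smooth_on_cong[OF open_grim_domain pd_grim_cylinder(2)]) (simp_all add: smooth_on_const)
  ultimately have "smooth_on grim_domain (pd i grim_cylinder)" for i using exhaust_2[of i] by metis
  \<comment> \<open>\<open>rev_cases\<close> splits off the last entry of \<open>js\<close>, which
    is the derivative taken first; the others act on a smooth function.\<close>
  then show "foldr pd js grim_cylinder differentiable (at p)"
    using p has_derivative_grim_cylinder[OF p]
    by (cases js rule: rev_cases) (auto simp: smooth_on_def differentiable_def)
qed

lemma embedded_surface_grim_cylinder: "embedded_surface grim_domain grim_cylinder"
  unfolding embedded_surface_def
proof (intro conjI ballI exI)
  show "inj (frechet_derivative grim_cylinder (at p))" if "p \<in> grim_domain" for p
    by (auto simp: frechet_derivative_grim_cylinder[OF that] inj_def coord_simps)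
  have v: "vector [p $ 1, p $ 2] = p" for p :: "real^2" by (simp add: vec_eq_iff forall_2)
  \<comment> \<open>The parameters \<open>x\<close> and \<open>y\<close> are the second and third
    coordinates of the image point.\<close>
  show "homeomorphism grim_domain (grim_cylinder ` grim_domain) grim_cylinder (\<lambda>v. vector [v $ 2, v $ 3])"
  proof (rule homeomorphismI)
    show "continuous_on grim_domain grim_cylinder"
      using smooth_on_continuous_on[OF smooth_on_grim_cylinder] .
    have "(\<lambda>v :: real^4. vector [v $ 2, v $ 3] :: real^2) = (\<lambda>v. (v $ 2) *\<^sub>R axis 1 1 + (v $ 3) *\<^sub>R axis 2 1)"
      (is "?f = _")
      by (simp add: fun_eq_iff coord_simps)
    then show "continuous_on (grim_cylinder ` grim_domain) ?f"
      by (simp only:) (intro continuous_intros)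
  qed (auto simp: grim_cylinder_def vector_4 v)
qed (simp_all add: open_grim_domain smooth_on_grim_cylinder)

text \<open>\<open>J\<close> sends the frame \<open>(tan x, 1, 0, 0)\<close>,
  \<open>(0, 0, 1, 0)\<close> to \<open>(1, - tan x, 0, 0)\<close>, \<open>(0, 0, 0, -1)\<close>,
  and these are orthogonal to the frame.\<close>

lemma lagrangian_grim_cylinder: "lagrangian_surface grim_domain grim_cylinder"
  by (auto simp: lagrangian_surface_def tangent_space_def frechet_derivative_grim_cylinder
      kahler_form_def J_def coord_simps algebra_simps)

section \<open>Induced metric, normal projection and second fundamental form\<close>

lemma metric_grim_cylinder:
  assumes "p \<in> grim_domain"
  shows "metric grim_cylinder p = (\<chi> i j. if i = j then if i = 1 then inverse ((cos (p $ 1))\<^sup>2) else 1 else 0)"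
  using tan_sec[of "p $ 1"] cos_pos_grim_domain[OF assms]
  by (simp add: metric_def pd_grim_cylinder[OF assms] coord_simps power2_eq_square)

text \<open>\<open>matrix_inv\<close> chooses a two-sided inverse. The matrix \<open>?B\<close>
  shows that one exists and, multiplied from the left, identifies the chosen one.\<close>

lemma metric_inv_grim_cylinder:
  assumes "p \<in> grim_domain"
  shows "metric_inv grim_cylinder p $ i $ j = (if i = j then if i = 1 then (cos (p $ 1))\<^sup>2 else 1 else 0)"
proof -
  let ?B = "(\<chi> i j. if i = j then if i = 1 then (cos (p $ 1))\<^sup>2 else 1 else 0) :: real^2^2"
  have AB: "metric grim_cylinder p ** ?B = mat 1"
    using cos_pos_grim_domain[OF assms]
    by (simp add: metric_grim_cylinder[OF assms] matrix_matrix_mult_def mat_def coord_simps)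
  then have BA: "?B ** metric grim_cylinder p = mat 1" using matrix_left_right_inverse by blast
  have "metric grim_cylinder p ** metric_inv grim_cylinder p = mat 1"
    unfolding metric_inv_def matrix_inv_def by (rule someI2[where a = ?B]) (use AB BA in auto)
  then have "?B ** (metric grim_cylinder p ** metric_inv grim_cylinder p) = ?B ** mat 1" by simp
  then have "metric_inv grim_cylinder p = ?B"
    by (simp only: matrix_mul_assoc BA matrix_mul_lid matrix_mul_rid)
  then show ?thesis by simp
qed

lemma sqrt_det_metric_grim_cylinder:
  assumes "p \<in> grim_domain"
  shows "sqrt (det (metric grim_cylinder p)) = 1 / cos (p $ 1)"
  using cos_pos_grim_domain[OF assms]
  by (simp add: metric_grim_cylinder[OF assms] det_2 real_sqrt_inverse flip: inverse_eq_divide)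

text \<open>This is \<open>cos x\<close> times \<open>J\<close> of the first coordinate tangent
  vector, hence a unit normal on the domain.\<close>

definition grim_normal :: "real^2 \<Rightarrow> real^4" where
  "grim_normal p = vector [cos (p $ 1), - sin (p $ 1), 0, 0]"

text \<open>The unit tangent \<open>(sin x, cos x, 0, 0)\<close> is \<open>cos x\<close> times the
  first coordinate vector, which explains the outer factor \<open>cos x\<close>.\<close>

lemma tangent_coeff_grim_cylinder:
  assumes "p \<in> grim_domain"
  shows "tangent_coeff grim_cylinder p w 1 = cos (p $ 1) * (w $ 1 * sin (p $ 1) + w $ 2 * cos (p $ 1))"
    and "tangent_coeff grim_cylinder p w 2 = w $ 3"
  using cos_pos_grim_domain[OF assms]
  by (simp_all add: tangent_coeff_def metric_inv_grim_cylinder[OF assms] pd_grim_cylinder[OF assms]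
      coord_simps tan_def field_simps power2_eq_square)

text \<open>\<open>grim_normal p\<close> and \<open>axis 4 1\<close> form an orthonormal basis of
  the normal space, so the projection is read off from inner products.\<close>

lemma normal_part_grim_cylinder:
  assumes "p \<in> grim_domain"
  shows "normal_part grim_cylinder p w = (w \<bullet> grim_normal p) *\<^sub>R grim_normal p + (w $ 4) *\<^sub>R axis 4 1"
proof -
  \<comment> \<open>These are the first two coordinates of the claim; both come down to
    \<open>sin^2 + cos^2 = 1\<close>.\<close>
  have "w1 - cos t * (w1 * sin t + w2 * cos t) * tan t = (w1 * cos t - w2 * sin t) * cos t"
    and "w2 - cos t * (w1 * sin t + w2 * cos t) = - ((w1 * cos t - w2 * sin t) * sin t)"
    if "cos t > 0" for w1 w2 t :: real
  proof -
    have "cos t * (w1 * sin t + w2 * cos t) * tan t = (w1 * sin t + w2 * cos t) * sin t"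
      using that by (simp add: tan_def)
    moreover have "sin t * sin t = 1 - cos t * cos t"
      using sin_squared_eq[of t] by (simp add: power2_eq_square)
    ultimately show "w1 - cos t * (w1 * sin t + w2 * cos t) * tan t = (w1 * cos t - w2 * sin t) * cos t"
      "w2 - cos t * (w1 * sin t + w2 * cos t) = - ((w1 * cos t - w2 * sin t) * sin t)"
      by algebra+
  qed
  from this[OF cos_pos_grim_domain[OF assms]] show ?thesis
    by (simp add: normal_part_def tangent_part_def tangent_coeff_grim_cylinder[OF assms] sum_2
        pd_grim_cylinder[OF assms] grim_normal_def coord_simps)
qed

text \<open>The only nonzero second partial derivative is \<open>axis 1 1\<close> divided by
  \<open>cos^2 x\<close>, and its inner product with the unit normal is
  \<open>1 / cos x\<close>.\<close>

lemma second_ff_grim_cylinder: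
  assumes "p \<in> grim_domain"
  shows "second_ff grim_cylinder i j p = (if i = 1 \<and> j = 1 then (1 / cos (p $ 1)) *\<^sub>R grim_normal p else 0)"
proof -
  have 2: "pd i (pd 2 grim_cylinder) p = 0" for i
    by (subst pd_cong[OF open_grim_domain assms pd_grim_cylinder(2)]) (auto intro: pd_eqI[OF has_derivative_const])
  have "((\<lambda>q. vector [tan (q $ 1), 1, 0, 0] :: real^4) has_derivative
      (\<lambda>h. (inverse ((cos (p $ 1))\<^sup>2) * h $ 1) *\<^sub>R axis 1 1)) (at p)"
  proof -
    have "(\<lambda>q. vector [tan (q $ 1), 1, 0, 0] :: real^4) = (\<lambda>q :: real^2. tan (q $ 1) *\<^sub>R axis 1 1 + axis 2 1)"
      by (simp add: fun_eq_iff coord_simps)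
    then show ?thesis using cos_pos_grim_domain[OF assms]
      by (auto intro!: derivative_eq_intros simp: coord_simps divide_inverse)
  qed
  then have "pd i (pd 1 grim_cylinder) p = (inverse ((cos (p $ 1))\<^sup>2) * axis i 1 $ 1) *\<^sub>R axis 1 1" for i
    by (subst pd_cong[OF open_grim_domain assms pd_grim_cylinder(1)]) (auto dest: pd_eqI)
  moreover have inv: "inverse (cos (p $ 1)) * inverse (cos (p $ 1)) * cos (p $ 1) * cos (p $ 1) = 1"
    using cos_pos_grim_domain[OF assms] by (simp add: field_simps)
  ultimately show ?thesis using exhaust_2[of j] exhaust_2[of i] 2 cos_pos_grim_domain[OF assms]
    by (auto simp: second_ff_def normal_part_grim_cylinder[OF assms] inner_axis'
        grim_normal_def coord_simps power2_eq_square divide_inverse inv)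
qed

text \<open>Both sides equal \<open>cos x\<close> times the unit normal: on the left this is the
  inner product with \<open>grim_T\<close>, on the right the trace
  \<open>cos^2 x * (1 / cos x)\<close>.\<close>

lemma translating_soliton_grim_cylinder: "translating_soliton grim_domain grim_cylinder grim_T"
  unfolding translating_soliton_def
proof
  fix p assume p: "p \<in> grim_domain"
  show "normal_part grim_cylinder p grim_T = mean_curvature grim_cylinder p"
    using cos_pos_grim_domain[OF p]
    by (simp add: mean_curvature_def second_ff_grim_cylinder[OF p] metric_inv_grim_cylinder[OF p]
        normal_part_grim_cylinder[OF p] grim_T_def grim_normal_def coord_simps power2_eq_square)
qed

lemma DERIV_inverse_cos_squared:
  assumes "cos x \<noteq> 0"
  shows "((\<lambda>x. inverse ((cos x)\<^sup>2)) has_real_derivative 2 * tan x / (cos x)\<^sup>2) (at x)"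
  using assms by (auto intro!: derivative_eq_intros simp: tan_def field_simps power2_eq_square)

text \<open>Only the metric coefficient \<open>1 / cos^2 x\<close> varies, and only with
  \<open>x\<close>. As the inverse metric is diagonal, the Laplacian involves just the symbols with
  equal lower indices.\<close>

lemma christoffel_grim_cylinder:
  assumes "p \<in> grim_domain"
  shows "christoffel grim_cylinder k 1 1 p = (if k = 1 then tan (p $ 1) else 0)"
    and "christoffel grim_cylinder k 2 2 p = 0"
proof -
  have D: "((\<lambda>x. inverse ((cos x)\<^sup>2)) has_real_derivative 2 * tan (p $ 1) / (cos (p $ 1))\<^sup>2) (at (p $ 1))"
    by (rule DERIV_inverse_cos_squared) (use cos_pos_grim_domain[OF assms] in simp)
  have "pd l (\<lambda>q. metric grim_cylinder q $ i $ j) p =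
      pd l (\<lambda>q. if i = j then if i = 1 then inverse ((cos (q $ 1))\<^sup>2) else 1 else 0) p" for i j l
    by (rule pd_cong[OF open_grim_domain assms]) (simp add: metric_grim_cylinder)
  then have m: "pd l (\<lambda>q. metric grim_cylinder q $ i $ j) p =
      (if i = 1 \<and> j = 1 \<and> l = 1 then 2 * tan (p $ 1) / (cos (p $ 1))\<^sup>2 else 0)" for i j l
    using pd_first_coord(1,2)[OF D] exhaust_2[of l] pd_eqI[OF has_derivative_const, of l _ p]
    by (cases "i = j"; cases "i = 1") auto
  show "christoffel grim_cylinder k 1 1 p = (if k = 1 then tan (p $ 1) else 0)"
    and "christoffel grim_cylinder k 2 2 p = 0"
    using cos_pos_grim_domain[OF assms] exhaust_2[of k]
    by (auto simp: christoffel_def m sum_2 metric_inv_grim_cylinder[OF assms])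
qed


section \<open>Stability\<close>

text \<open>Differentiation in \<open>x\<close> sends the coefficients \<open>(a, b)\<close> to
  \<open>(b, - a)\<close>, so the span of \<open>cos\<close> and \<open>sin\<close> is closed under
  \<open>pd\<close>. It contains the components of \<open>grim_normal\<close>.\<close>

lemma smooth_on_cos_sin:
  assumes "open U"
  shows "smooth_on U (\<lambda>p. a * cos (p $ 1) + b * sin (p $ 1))"
proof (rule smooth_on_coinduct[OF assms,
      where P = "range (\<lambda>(a, b) p. a * cos (p $ 1) + b * sin (p $ 1))"])
  fix g :: "real^2 \<Rightarrow> real"
  assume "g \<in> range (\<lambda>(a, b) p. a * cos (p $ 1) + b * sin (p $ 1))"
  then obtain a b where g: "g = (\<lambda>p. a * cos (p $ 1) + b * sin (p $ 1))" by auto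
  have D: "((\<lambda>x. a * cos x + b * sin x) has_real_derivative b * cos x + (- a) * sin x) (at x)" for x
    by (auto intro!: derivative_eq_intros)
  show "g differentiable (at p)" for p
    unfolding g using pd_first_coord(3)[OF D] .
  show "\<exists>k\<in>range (\<lambda>(a, b) p. a * cos (p $ 1) + b * sin (p $ 1)). \<forall>p\<in>U. pd i g p = k p" for i
  proof (cases "i = 1")
    case True
    have "pd i g p = b * cos (p $ 1) + (- a) * sin (p $ 1)" for p
      unfolding g True using pd_first_coord(1)[OF D] .
    then show ?thesis by (intro bexI[OF _ rangeI[of _ "(b, - a)"]]) simp
  next
    case False
    then have "i = 2" using exhaust_2[of i] by blast
    then have "pd i g p = 0" for p
      unfolding g using pd_first_coord(2)[OF D] by simp
    then show ?thesis by (intro bexI[OF _ rangeI[of _ "(0, 0)"]]) simp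
  qed
qed (auto intro: rangeI[of _ "(a, b)"])

section \<open>The parallel normal frame and the stability operator\<close>

text \<open>The derivative is a multiple of the unit tangent \<open>(sin x, cos x, 0, 0)\<close>;
  its normal part vanishes on the domain, so the field is parallel there.\<close>

lemma has_derivative_grim_normal:
  "(grim_normal has_derivative (\<lambda>h. (- h $ 1) *\<^sub>R vector [sin (p $ 1), cos (p $ 1), 0, 0])) (at p)"
proof -
  have eq: "grim_normal = (\<lambda>q. cos (q $ 1) *\<^sub>R axis 1 1 + (- sin (q $ 1)) *\<^sub>R axis 2 1)"
    by (simp add: fun_eq_iff grim_normal_def coord_simps)
  show ?thesis
    unfolding eq by (auto intro!: derivative_eq_intros simp: coord_simps)
qed

lemma inner_grim_normal_self: "grim_normal p \<bullet> grim_normal p = 1"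
  by (simp add: grim_normal_def coord_simps flip: power2_eq_square)

text \<open>Since the normal frame is parallel, the connection differentiates the components. The
  result has again the form assumed of \<open>W\<close>, so the lemma can be iterated for second
  covariant derivatives.\<close>

lemma normal_conn_grim_cylinder:
  assumes p: "p \<in> grim_domain"
    and W: "\<And>q. q \<in> grim_domain \<Longrightarrow> W q = u q *\<^sub>R grim_normal q + w q *\<^sub>R axis 4 1"
    and "u differentiable (at p)" "w differentiable (at p)"
  shows "normal_conn grim_cylinder i W p = pd i u p *\<^sub>R grim_normal p + pd i w p *\<^sub>R axis 4 1"
proof -
  have "pd i W p = pd i (\<lambda>q. u q *\<^sub>R grim_normal q + w q *\<^sub>R axis 4 1) p"
    by (rule pd_cong[OF open_grim_domain p W])
  also have "((\<lambda>q. u q *\<^sub>R grim_normal q + w q *\<^sub>R axis 4 1 :: real^4) has_derivative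
      (\<lambda>h. u p *\<^sub>R (- h $ 1) *\<^sub>R vector [sin (p $ 1), cos (p $ 1), 0, 0]
        + frechet_derivative u (at p) h *\<^sub>R grim_normal p
        + frechet_derivative w (at p) h *\<^sub>R axis 4 1)) (at p)"
    using assms(3,4)[THEN frechet_derivative_works[THEN iffD1]]
    by (auto intro!: derivative_eq_intros has_derivative_grim_normal)
  note pd_eqI[OF this, of i]
  finally have "pd i W p = (- u p * axis i 1 $ 1) *\<^sub>R vector [sin (p $ 1), cos (p $ 1), 0, 0]
      + pd i u p *\<^sub>R grim_normal p + pd i w p *\<^sub>R axis 4 1" by (simp add: pd_def)
  moreover have "vector [sin (p $ 1), cos (p $ 1), 0, 0] \<bullet> grim_normal p = 0"
    "axis 4 1 \<bullet> grim_normal p = 0"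
    "(vector [sin (p $ 1), cos (p $ 1), 0, 0] :: real^4) $ 4 = 0" "grim_normal p $ 4 = 0"
    by (simp_all add: grim_normal_def coord_simps)
  ultimately show ?thesis
    by (simp add: normal_conn_def normal_part_grim_cylinder[OF p] inner_add_left inner_diff_left
        inner_grim_normal_self)
qed

text \<open>The Christoffel term \<open>- cos^2 x * tan x\<close> and the drift
  \<open>cos x * sin x\<close> from the tangential part of \<open>grim_T\<close> cancel, so no first
  derivatives remain. The curvature term acts on \<open>u\<close> alone, with coefficient
  \<open>cos^4 x * (1 / cos x)^2 = cos^2 x\<close>.\<close>

lemma stability_op_grim_cylinder:
  assumes p: "p \<in> grim_domain"
    and V: "\<And>q. q \<in> grim_domain \<Longrightarrow> V q = u q *\<^sub>R grim_normal q + w q *\<^sub>R axis 4 1"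
    and u: "smooth_on grim_domain u" and w: "smooth_on grim_domain w"
  shows "stability_op grim_cylinder grim_T V p =
     ((cos (p $ 1))\<^sup>2 * (pd 1 (pd 1 u) p + u p) + pd 2 (pd 2 u) p) *\<^sub>R grim_normal p
     + ((cos (p $ 1))\<^sup>2 * pd 1 (pd 1 w) p + pd 2 (pd 2 w) p) *\<^sub>R axis 4 1"
proof -
  have 1: "normal_conn grim_cylinder i V q = pd i u q *\<^sub>R grim_normal q + pd i w q *\<^sub>R axis 4 1"
    if "q \<in> grim_domain" for i q
    by (rule normal_conn_grim_cylinder[OF that V]) (auto intro: smooth_on_differentiable u w that)
  have 2: "normal_conn grim_cylinder i (normal_conn grim_cylinder j V) p
    = pd i (pd j u) p *\<^sub>R grim_normal p + pd i (pd j w) p *\<^sub>R axis 4 1" for i j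
    by (rule normal_conn_grim_cylinder[OF p 1]) (auto intro: smooth_on_differentiable smooth_on_pd u w p)
  have n4: "axis 4 1 \<bullet> grim_normal p = 0" "grim_normal p $ 4 = 0"
    by (simp_all add: grim_normal_def coord_simps)
  have T: "tangent_coeff grim_cylinder p grim_T 1 = cos (p $ 1) * sin (p $ 1)"
    "tangent_coeff grim_cylinder p grim_T 2 = 0"
    by (simp_all add: tangent_coeff_grim_cylinder[OF p] grim_T_def vector_4)
  have ct: "(cos (p $ 1))\<^sup>2 * tan (p $ 1) = cos (p $ 1) * sin (p $ 1)"
    using cos_pos_grim_domain[OF p] by (simp add: tan_def power2_eq_square)
  have lap: "normal_laplacian grim_cylinder V p =
      ((cos (p $ 1))\<^sup>2 * pd 1 (pd 1 u) p - (cos (p $ 1))\<^sup>2 * tan (p $ 1) * pd 1 u p + pd 2 (pd 2 u) p) *\<^sub>R grim_normal p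
    + ((cos (p $ 1))\<^sup>2 * pd 1 (pd 1 w) p - (cos (p $ 1))\<^sup>2 * tan (p $ 1) * pd 1 w p + pd 2 (pd 2 w) p) *\<^sub>R axis 4 1"
    by (simp add: normal_laplacian_def sum_2 metric_inv_grim_cylinder[OF p] christoffel_grim_cylinder[OF p]
        1[OF p] 2 scaleR_add_left scaleR_add_right scaleR_diff_left scaleR_diff_right algebra_simps)
  show ?thesis
    using lap[unfolded ct] cos_pos_grim_domain[OF p]
    by (simp add: stability_op_def sum_2 metric_inv_grim_cylinder[OF p] T 1[OF p] second_ff_grim_cylinder[OF p]
        V[OF p] inner_add_right inner_grim_normal_self n4 inner_commute[of "grim_normal p" "axis 4 1"]
        power2_eq_square algebra_simps)
qed

text \<open>The tangential part vanishes, so the vector equals its own normal projection.\<close>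

lemma normal_field_grim_cylinder:
  assumes p: "p \<in> grim_domain" and V: "\<forall>w\<in>tangent_space grim_cylinder p. V \<bullet> w = 0"
  shows "V = (V \<bullet> grim_normal p) *\<^sub>R grim_normal p + (V $ 4) *\<^sub>R axis 4 1"
proof -
  have "pd i grim_cylinder p \<in> tangent_space grim_cylinder p" for i
    by (simp add: tangent_space_def pd_def)
  then have "V \<bullet> pd i grim_cylinder p = 0" for i using V by blast
  then show ?thesis
    using normal_part_grim_cylinder[OF p, of V]
    by (simp add: normal_part_def tangent_part_def tangent_coeff_def)
qed

section \<open>Nonnegativity of the second variation\<close>

lemma stability_grim_cylinder:
  assumes "compact_normal_field grim_domain grim_cylinder V"
  shows "surface_integral grim_domain grim_cylinder
    (\<lambda>p. (stability_op grim_cylinder grim_T V p \<bullet> V p) * exp (grim_T \<bullet> grim_cylinder p)) \<le> 0"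
proof -
  define u where "u p = V p \<bullet> grim_normal p" for p
  define w where "w p = V p $ 4" for p
  obtain K where K: "compact K" "K \<subseteq> grim_domain" "\<And>p. p \<in> grim_domain - K \<Longrightarrow> V p = 0"
    and smV: "smooth_on grim_domain V"
    and nV: "\<And>p. p \<in> grim_domain \<Longrightarrow> \<forall>w\<in>tangent_space grim_cylinder p. V p \<bullet> w = 0"
    using assms unfolding compact_normal_field_def by blast
  have V: "V p = u p *\<^sub>R grim_normal p + w p *\<^sub>R axis 4 1" if "p \<in> grim_domain" for p
    unfolding u_def w_def using normal_field_grim_cylinder[OF that nV[OF that]] .
  note smooth_comp = smooth_on_bounded_linear[OF open_grim_domain bounded_linear_vec_nth smV]
  have smw: "smooth_on grim_domain w" unfolding w_def using smooth_comp .
  have smu: "smooth_on grim_domain u"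
  proof -
    \<comment> \<open>The inner product with \<open>grim_normal\<close>, with \<open>cos\<close> and
      \<open>- sin\<close> written as members of the family in
      \<open>smooth_on_cos_sin\<close>.\<close>
    have "smooth_on grim_domain (\<lambda>p. V p $ 1 * (1 * cos (p $ 1) + 0 * sin (p $ 1))
        + V p $ 2 * (0 * cos (p $ 1) + (- 1) * sin (p $ 1)))"
      by (intro smooth_on_add smooth_on_mult smooth_comp smooth_on_cos_sin open_grim_domain)
    then show ?thesis by (simp add: u_def[abs_def] grim_normal_def coord_simps)
  qed
  note D [simp] = smu[THEN smooth_on_differentiable] smw[THEN smooth_on_differentiable]
    smu[THEN smooth_on_pd, THEN smooth_on_differentiable] smw[THEN smooth_on_pd, THEN smooth_on_differentiable]
  note C [continuous_intros] = smu[THEN smooth_on_continuous_on] smw[THEN smooth_on_continuous_on]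
    smu[THEN smooth_on_pd, THEN smooth_on_continuous_on] smw[THEN smooth_on_pd, THEN smooth_on_continuous_on]
    smu[THEN smooth_on_pd, THEN smooth_on_pd, THEN smooth_on_continuous_on]
    smw[THEN smooth_on_pd, THEN smooth_on_pd, THEN smooth_on_continuous_on]
  have c0: "cos (p $ 1) \<noteq> 0" if "p \<in> grim_domain" for p
    using cos_pos_grim_domain[OF that] by simp
  \<comment> \<open>The weighted integrand \<open>F\<close> will be the divergence of
    \<open>(P, Q)\<close> minus the sum of squares \<open>S\<close>. The first square is that of
    \<open>u_x + u tan x = cos x * (u / cos x)_x\<close>, which produces the term with
    \<open>tan\<close> in \<open>P\<close>. The weight in \<open>Q\<close> is constant in
    \<open>y\<close>.\<close>
  define P where "P p = u p * pd 1 u p + w p * pd 1 w p + tan (p $ 1) * (u p * u p)" for p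
  define Q where "Q p = inverse ((cos (p $ 1))\<^sup>2) * (u p * pd 2 u p + w p * pd 2 w p)" for p
  define S where "S p = (pd 1 u p + tan (p $ 1) * u p)\<^sup>2 + (pd 1 w p)\<^sup>2
    + ((pd 2 u p)\<^sup>2 + (pd 2 w p)\<^sup>2) / (cos (p $ 1))\<^sup>2" for p
  have tand: "(\<lambda>q. tan (q $ 1)) differentiable (at p)"
    "pd 1 (\<lambda>q. tan (q $ 1)) p = inverse ((cos (p $ 1))\<^sup>2)" if "p \<in> grim_domain" for p
    using pd_first_coord[OF DERIV_tan[OF c0[OF that]]] by auto
  have secd: "(\<lambda>q. inverse ((cos (q $ 1))\<^sup>2)) differentiable (at p)"
    "pd 2 (\<lambda>q. inverse ((cos (q $ 1))\<^sup>2)) p = 0" if "p \<in> grim_domain" for p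
    using pd_first_coord[OF DERIV_inverse_cos_squared[OF c0[OF that]]] by auto
  have Pd: "P differentiable (at p)" if "p \<in> grim_domain" for p
    unfolding P_def[abs_def] using that tand by simp
  have Qd: "Q differentiable (at p)" if "p \<in> grim_domain" for p
    unfolding Q_def[abs_def] using that by (intro differentiable_mult secd) auto
  have P1: "pd 1 P p = (pd 1 u p)\<^sup>2 + u p * pd 1 (pd 1 u) p + (pd 1 w p)\<^sup>2 + w p * pd 1 (pd 1 w) p
      + (u p)\<^sup>2 / (cos (p $ 1))\<^sup>2 + 2 * tan (p $ 1) * u p * pd 1 u p" if "p \<in> grim_domain" for p
    unfolding P_def[abs_def] using that tand
    by (simp add: pd_add pd_mult divide_inverse power2_eq_square algebra_simps)
  have Q2: "pd 2 Q p = ((pd 2 u p)\<^sup>2 + u p * pd 2 (pd 2 u) p + (pd 2 w p)\<^sup>2 + w p * pd 2 (pd 2 w) p)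
      / (cos (p $ 1))\<^sup>2" if "p \<in> grim_domain" for p
  proof -
    let ?R = "\<lambda>p. u p * pd 2 u p + w p * pd 2 w p"
    have "?R differentiable (at p)" using that by simp
    moreover have "pd 2 ?R p = (pd 2 u p)\<^sup>2 + u p * pd 2 (pd 2 u) p + (pd 2 w p)\<^sup>2 + w p * pd 2 (pd 2 w) p"
      using that by (simp add: pd_add pd_mult power2_eq_square)
    ultimately show ?thesis
      unfolding Q_def[abs_def] by (subst pd_mult) (use that secd in \<open>simp_all add: divide_inverse\<close>)
  qed
  have tc: "continuous_on grim_domain (\<lambda>p. tan (p $ 1))"
    and sc: "continuous_on grim_domain (\<lambda>p. inverse ((cos (p $ 1))\<^sup>2))"
    using tand secd by (blast intro: continuous_at_imp_continuous_on differentiable_imp_continuous_within)+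
  have Pc: "continuous_on grim_domain (pd 1 P)"
    by (subst continuous_on_cong[OF refl P1], assumption)
       (unfold divide_inverse, intro continuous_intros tc sc)
  have Qc: "continuous_on grim_domain (pd 2 Q)"
    by (subst continuous_on_cong[OF refl Q2], assumption)
       (unfold divide_inverse, intro continuous_intros tc sc)
  \<comment> \<open>Every term of \<open>P\<close> and \<open>Q\<close> has an undifferentiated
    factor \<open>u\<close> or \<open>w\<close>, so the vanishing of \<open>V\<close> is
    enough.\<close>
  have PQ0: "P p = 0" "Q p = 0" if "p \<in> grim_domain - K" for p
    using K(3)[OF that] by (simp_all add: P_def Q_def u_def w_def)
  have IP: "set_integrable lborel grim_domain (pd 1 P)" "(LINT p:grim_domain|lborel. pd 1 P p) = 0"
    by (rule set_integral_pd_eq_0[OF open_grim_domain _ Pc K(1,2)], erule Pd, erule PQ0)+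
  have IQ: "set_integrable lborel grim_domain (pd 2 Q)" "(LINT p:grim_domain|lborel. pd 2 Q p) = 0"
    by (rule set_integral_pd_eq_0[OF open_grim_domain _ Qc K(1,2)], erule Qd, erule PQ0)+
  define F where "F p = stability_op grim_cylinder grim_T V p \<bullet> V p
      * exp (grim_T \<bullet> grim_cylinder p) * sqrt (det (metric grim_cylinder p))" for p
  have F: "F p = pd 1 P p + pd 2 Q p - S p" if p: "p \<in> grim_domain" for p
  proof -
    \<comment> \<open>With the area element \<open>1 / cos x\<close>, this gives the total weight
      \<open>1 / cos^2 x\<close>, which cancels the \<open>cos^2 x\<close> in the stability
      operator.\<close>
    have e: "exp (grim_T \<bullet> grim_cylinder p) = 1 / cos (p $ 1)"
      using cos_pos_grim_domain[OF p]
      by (simp add: grim_T_def grim_cylinder_def coord_simps exp_minus inverse_eq_divide)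
    have n4: "axis 4 1 \<bullet> grim_normal p = 0" "grim_normal p \<bullet> axis 4 1 = 0"
      by (simp_all add: grim_normal_def coord_simps)
    have st: "stability_op grim_cylinder grim_T V p =
     ((cos (p $ 1))\<^sup>2 * (pd 1 (pd 1 u) p + u p) + pd 2 (pd 2 u) p) *\<^sub>R grim_normal p
     + ((cos (p $ 1))\<^sup>2 * pd 1 (pd 1 w) p + pd 2 (pd 2 w) p) *\<^sub>R axis 4 1"
      by (rule stability_op_grim_cylinder[OF p V smu smw])
    have "stability_op grim_cylinder grim_T V p \<bullet> V p =
      ((cos (p $ 1))\<^sup>2 * (pd 1 (pd 1 u) p + u p) + pd 2 (pd 2 u) p) * u p
      + ((cos (p $ 1))\<^sup>2 * pd 1 (pd 1 w) p + pd 2 (pd 2 w) p) * w p"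
      by (simp add: st V[OF p] inner_add_left inner_add_right
        inner_grim_normal_self n4 inner_axis_axis)
    then have "F p = (pd 1 (pd 1 u) p + u p) * u p + pd 1 (pd 1 w) p * w p
        + (pd 2 (pd 2 u) p * u p + pd 2 (pd 2 w) p * w p) / (cos (p $ 1))\<^sup>2"
      using c0[OF p] by (simp add: F_def e sqrt_det_metric_grim_cylinder[OF p] field_simps power2_eq_square)
    \<comment> \<open>The term \<open>u^2 / cos^2 x\<close> in \<open>pd 1 P\<close> splits into the
      potential term \<open>u^2\<close> of \<open>F\<close> and the part that completes the square
      in \<open>S\<close>.\<close>
    moreover have "(u p)\<^sup>2 / (cos (p $ 1))\<^sup>2 = (u p)\<^sup>2 + (tan (p $ 1) * u p)\<^sup>2"
    proof -
      have "inverse ((cos (p $ 1))\<^sup>2) = 1 + (tan (p $ 1))\<^sup>2"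
        using tan_sec[OF c0[OF p]] by (simp add: power_inverse)
      then show ?thesis by (simp add: divide_inverse power_mult_distrib algebra_simps)
    qed
    ultimately show ?thesis
      unfolding P1[OF p] Q2[OF p] S_def
      by (simp add: power2_eq_square add_divide_distrib algebra_simps)
  qed
  have "(LINT p:grim_domain|lborel. F p) \<le> 0"
  \<comment> \<open>The case distinction takes the place of an integrability proof for
    \<open>F\<close>: the integral of a non-integrable function is 0 by convention.\<close>
  proof (cases "set_integrable lborel grim_domain F")
    case True
    have "(LINT p:grim_domain|lborel. F p) \<le> (LINT p:grim_domain|lborel. pd 1 P p + pd 2 Q p)"
    proof (rule set_integral_mono[OF True set_integral_add(1)[OF IP(1) IQ(1)]])
      fix p assume "p \<in> grim_domain"
      moreover have "S p \<ge> 0" by (simp add: S_def)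
      ultimately show "F p \<le> pd 1 P p + pd 2 Q p" using F by simp
    qed
    also have "\<dots> = 0" by (simp add: set_integral_add(2)[OF IP(1) IQ(1)] IP(2) IQ(2))
    finally show ?thesis .
  next
    case False
    then show ?thesis
      by (simp add: set_integrable_def set_lebesgue_integral_def not_integrable_integral_eq)
  qed
  then show ?thesis by (simp add: surface_integral_def F_def)
qed

theorem theorem1p2:
  shows "embedded_surface grim_domain grim_cylinder
    \<and> lagrangian_surface grim_domain grim_cylinder
    \<and> translating_soliton grim_domain grim_cylinder grim_T
    \<and> (\<forall>V :: real^2 \<Rightarrow> real^4. compact_normal_field grim_domain grim_cylinder V \<longrightarrow>
         - surface_integral grim_domain grim_cylinder
             (\<lambda>p. (stability_op grim_cylinder grim_T V p \<bullet> V p) * exp (grim_T \<bullet> grim_cylinder p))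
         \<ge> 0)"
  using embedded_surface_grim_cylinder lagrangian_grim_cylinder translating_soliton_grim_cylinder
    stability_grim_cylinder by simp

end
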